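(* Let $G$ be a finite abelian group of order $n\ge 2$, and let $l$ be the order of its subgroup of elements of order at most $2$. Then $C_2(G)=(n+l)/2$.
   Context: $G$ is written additively. For $A\subseteq G$ and a positive integer $h$, $h\hat{\;}A$ denotes the set of all sums of $h$ pairwise distinct elements of $A$. $C_h(G)=\max\{|A| : A\subseteq G,\ h\hat{\;}A\neq G\}$. *)

theory Defs
  imports Complex_Main "HOL-Algebra.Algebra"
begin

text \<open>
  HOL-Algebra writes abelian groups multiplicatively, so a sum of group elements is
  rendered as a \<^const>\<open>finprod\<close>. A choice of \<open>h\<close> pairwise distinct elements of \<open>A\<close>
  is an \<open>h\<close>-element subset of \<open>A\<close>.
\<close>

definition restricted_sumset :: "('a, 'b) monoid_scheme \<Rightarrow> nat \<Rightarrow> 'a set \<Rightarrow> 'a set" where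
  "restricted_sumset G h A = {finprod G (\<lambda>x. x) B | B. B \<subseteq> A \<and> finite B \<and> card B = h}"

text \<open>
  For a finite group and \<open>h > 0\<close> the maximum below is over a finite set, nonempty because
  of \<open>A = {}\<close>; for other arguments the value carries no meaning.
\<close>

definition max_incomplete_card :: "('a, 'b) monoid_scheme \<Rightarrow> nat \<Rightarrow> nat" where
  "max_incomplete_card G h =
     Max {card A | A. A \<subseteq> carrier G \<and> restricted_sumset G h A \<noteq> carrier G}"

end

theory Submission
  imports Defs
begin

text \<open>
  If \<open>g\<close> is not a sum of two distinct elements of \<open>A\<close>, then \<open>A\<close> meets its image under the
  involution \<open>x \<mapsto> g - x\<close> only in solutions of \<open>2x = g\<close>, and there are at most \<open>l\<close> of these, so
  \<open>2|A| \<le> n + l\<close>. For \<open>g = 0\<close>, a maximal \<open>A\<close> satisfies \<open>A \<union> -A = G\<close> and contains every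
  solution of \<open>2x = 0\<close>, so equality holds.
\<close>

text \<open>Connects the description of \<open>l\<close> by element orders with the equation
  \<open>x \<otimes> x = \<one>\<close>, which is the form all the counting below uses.\<close>

lemma (in group) ord_le_2_iff:
  assumes "finite (carrier G)" "x \<in> carrier G"
  shows "ord x \<le> 2 \<longleftrightarrow> x \<otimes> x = \<one>"
proof -
  have sq: "x [^] (2::nat) = x \<otimes> x"
    using assms by (simp add: numeral_2_eq_2)
  show ?thesis
  proof
    assume "ord x \<le> 2"
    \<comment> \<open>Finiteness enters here: an element of infinite order has
      \<open>ord x = 0\<close>, which would also satisfy the bound.\<close>
    moreover have "1 \<le> ord x" using ord_ge_1[OF assms] .
    ultimately have "ord x = 1 \<or> ord x = 2" by linarith
    then have "ord x dvd 2" by auto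
    then show "x \<otimes> x = \<one>" using sq pow_eq_id[OF assms(2), of 2] by simp
  next
    assume "x \<otimes> x = \<one>"
    then have "ord x dvd 2" using sq pow_eq_id[OF assms(2), of 2] by simp
    then show "ord x \<le> 2" by (rule dvd_imp_le) simp
  qed
qed

context comm_group
begin

lemma restricted_sumset_2:
  assumes "A \<subseteq> carrier G"
  shows "restricted_sumset G 2 A = {x \<otimes> y | x y. x \<in> A \<and> y \<in> A \<and> x \<noteq> y}"
proof -
  have pair: "finprod G (\<lambda>x. x) {x, y} = x \<otimes> y" if "x \<in> A" "y \<in> A" "x \<noteq> y" for x y
    using that assms by (subst finprod_insert) auto
  show ?thesis
  proof (intro equalityI subsetI)
    fix z assume "z \<in> restricted_sumset G 2 A"
    then obtain B where z: "z = finprod G (\<lambda>x. x) B" and "B \<subseteq> A" "card B = 2"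
      unfolding restricted_sumset_def by blast
    then obtain x y where "B = {x, y}" "x \<noteq> y" "x \<in> A" "y \<in> A"
      by (auto simp: card_2_iff)
    then show "z \<in> {x \<otimes> y | x y. x \<in> A \<and> y \<in> A \<and> x \<noteq> y}"
      using z pair[of x y] by blast
  next
    fix z assume "z \<in> {x \<otimes> y | x y. x \<in> A \<and> y \<in> A \<and> x \<noteq> y}"
    then obtain x y where "z = x \<otimes> y" "x \<in> A" "y \<in> A" "x \<noteq> y" by blast
    then show "z \<in> restricted_sumset G 2 A"
      unfolding restricted_sumset_def using pair
      by (intro CollectI exI[of _ "{x, y}"]) auto
  qed
qed

text \<open>Closure keeps the sumset inside the carrier, so it can differ from the carrier only by
  missing some \<open>g\<close>. This is the form in which incompleteness is used.\<close>

lemma restricted_sumset_2_eq_carrier_iff: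
  assumes "A \<subseteq> carrier G"
  shows "restricted_sumset G 2 A = carrier G
    \<longleftrightarrow> (\<forall>g\<in>carrier G. \<exists>x\<in>A. \<exists>y\<in>A. x \<noteq> y \<and> x \<otimes> y = g)"
proof -
  have "restricted_sumset G 2 A \<subseteq> carrier G"
    using assms unfolding restricted_sumset_2[OF assms] by (auto dest: subsetD)
  moreover have "g \<in> restricted_sumset G 2 A \<longleftrightarrow> (\<exists>x\<in>A. \<exists>y\<in>A. x \<noteq> y \<and> x \<otimes> y = g)" for g
    unfolding restricted_sumset_2[OF assms] by auto
  ultimately show ?thesis by (simp add: set_eq_subset subset_iff Ball_def)
qed

text \<open>If \<open>a\<close> is one solution of \<open>x \<otimes> x = g\<close>, then
  multiplication by \<open>inv a\<close> maps the solutions injectively into those of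
  \<open>x \<otimes> x = \<one>\<close>, because squaring is a homomorphism in a commutative
  group.\<close>

lemma card_square_roots_le:
  assumes "finite (carrier G)"
  shows "card {x \<in> carrier G. x \<otimes> x = g} \<le> card {x \<in> carrier G. x \<otimes> x = \<one>}"
proof (cases "{x \<in> carrier G. x \<otimes> x = g} = {}")
  case True
  then show ?thesis by (simp only: card.empty)
next
  case False
  then obtain a where a: "a \<in> carrier G" "a \<otimes> a = g" by blast
  show ?thesis
  proof (rule card_inj_on_le[where f = "\<lambda>x. x \<otimes> inv a"])
    show "inj_on (\<lambda>x. x \<otimes> inv a) {x \<in> carrier G. x \<otimes> x = g}"
      using a by (auto intro!: inj_onI)
    show "(\<lambda>x. x \<otimes> inv a) ` {x \<in> carrier G. x \<otimes> x = g} \<subseteq> {x \<in> carrier G. x \<otimes> x = \<one>}"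
    proof clarify
      fix x assume x: "x \<in> carrier G" and g: "g = x \<otimes> x"
      have "(x \<otimes> inv a) \<otimes> (x \<otimes> inv a) = (x \<otimes> x) \<otimes> inv (a \<otimes> a)"
        using x a(1) by (simp add: inv_mult m_ac)
      then show "x \<otimes> inv a \<in> carrier G \<and> x \<otimes> inv a \<otimes> (x \<otimes> inv a) = \<one>"
        using x a g by simp
    qed
    show "finite {x \<in> carrier G. x \<otimes> x = \<one>}" using assms by simp
  qed
qed

lemma card_image_mult_inv:
  assumes "A \<subseteq> carrier G" "g \<in> carrier G"
  shows "card ((\<lambda>x. g \<otimes> inv x) ` A) = card A"
proof (rule card_image, rule inj_onI)
  fix x y assume xy: "x \<in> A" "y \<in> A" and eq: "g \<otimes> inv x = g \<otimes> inv y"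
  from xy assms have c: "x \<in> carrier G" "y \<in> carrier G" by auto
  with eq assms(2) have "inv x = inv y" by simp
  then show "x = y" using c by (metis inv_inv)
qed

lemma card_missing_le:
  assumes fin: "finite (carrier G)" and A: "A \<subseteq> carrier G" and g: "g \<in> carrier G"
    and miss: "\<And>x y. x \<in> A \<Longrightarrow> y \<in> A \<Longrightarrow> x \<noteq> y \<Longrightarrow> x \<otimes> y \<noteq> g"
  shows "2 * card A \<le> order G + card {x \<in> carrier G. x \<otimes> x = \<one>}"
proof -
  let ?B = "(\<lambda>x. g \<otimes> inv x) ` A"
  have finA: "finite A" using fin A by (rule rev_finite_subset)
  have "A \<inter> ?B \<subseteq> {x \<in> carrier G. x \<otimes> x = g}"
  proof clarify
    fix y assume "g \<otimes> inv y \<in> A" "y \<in> A"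
    moreover from this have y: "y \<in> carrier G" using A by auto
    moreover have "g \<otimes> inv y \<otimes> y = g" using y g by (simp add: m_assoc)
    \<comment> \<open>The elements \<open>g \<otimes> inv y\<close> and \<open>y\<close> both lie in
      \<open>A\<close> and have product \<open>g\<close>. By \<open>miss\<close> they cannot be
      distinct, so the square of \<open>g \<otimes> inv y\<close> is \<open>g\<close>.\<close>
    ultimately show "g \<otimes> inv y \<in> carrier G \<and> g \<otimes> inv y \<otimes> (g \<otimes> inv y) = g"
      using miss[of "g \<otimes> inv y" y] g by (cases "g \<otimes> inv y = y") auto
  qed
  then have "card (A \<inter> ?B) \<le> card {x \<in> carrier G. x \<otimes> x = g}"
    using fin by (intro card_mono) auto
  also have "\<dots> \<le> card {x \<in> carrier G. x \<otimes> x = \<one>}" using card_square_roots_le[OF fin] .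
  finally have inter: "card (A \<inter> ?B) \<le> card {x \<in> carrier G. x \<otimes> x = \<one>}" .
  have union: "card (A \<union> ?B) \<le> order G"
    unfolding order_def using fin A g by (intro card_mono) auto
  \<comment> \<open>Inclusion-exclusion, with \<open>?B\<close> of the same size as
    \<open>A\<close>.\<close>
  have "2 * card A = card (A \<union> ?B) + card (A \<inter> ?B)"
    using card_Un_Int[of A ?B] finA card_image_mult_inv[OF A g] by simp
  then show ?thesis using inter union by simp
qed

text \<open>Maximality under inclusion is enough: it forces \<open>A\<close> to contain
  \<open>x\<close> or \<open>inv x\<close> for every \<open>x\<close>, which makes both estimates in
  the proof of \<open>card_missing_le\<close> sharp for \<open>g = \<one>\<close>.\<close>

lemma exists_card_missing_one:
  assumes fin: "finite (carrier G)"
  obtains A where "A \<subseteq> carrier G" "\<And>x y. x \<in> A \<Longrightarrow> y \<in> A \<Longrightarrow> x \<noteq> y \<Longrightarrow> x \<otimes> y \<noteq> \<one>"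
    "2 * card A = order G + card {x \<in> carrier G. x \<otimes> x = \<one>}"
proof -
  define S where
    "S = {A. A \<subseteq> carrier G \<and> (\<forall>x\<in>A. \<forall>y\<in>A. x \<noteq> y \<longrightarrow> x \<otimes> y \<noteq> \<one>)}"
  have "finite S" "S \<noteq> {}" using fin by (auto simp: S_def)
  then obtain A where AS: "A \<in> S" and max: "\<And>A'. A' \<in> S \<Longrightarrow> A \<subseteq> A' \<Longrightarrow> A' = A"
    using finite_has_maximal[of S] by metis
  have A: "A \<subseteq> carrier G" and miss: "\<And>x y. x \<in> A \<Longrightarrow> y \<in> A \<Longrightarrow> x \<noteq> y \<Longrightarrow> x \<otimes> y \<noteq> \<one>"
    using AS by (auto simp: S_def)
  \<comment> \<open>The only partner of \<open>x\<close> with product \<open>\<one>\<close> is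
    \<open>inv x\<close>. If neither is in \<open>A\<close>, adding \<open>x\<close> creates no
    forbidden pair, against maximality.\<close>
  have cover: "x \<in> A \<or> inv x \<in> A" if x: "x \<in> carrier G" for x
  proof (rule ccontr)
    assume no: "\<not> (x \<in> A \<or> inv x \<in> A)"
    have "x \<otimes> y \<noteq> \<one>" if "y \<in> A" for y
    proof
      have y: "y \<in> carrier G" using that A by auto
      assume "x \<otimes> y = \<one>"
      then have "inv x = y" using x y inv_equality[of y x] m_comm[of x y] by simp
      then show False using no that by simp
    qed
    moreover from this have "y \<otimes> x \<noteq> \<one>" if "y \<in> A" for y
      using that x A m_comm[of x y] by auto
    ultimately have "insert x A \<in> S" using AS x by (auto simp: S_def)
    then show False using max[of "insert x A"] no by blast
  qed
  \<comment> \<open>The factor \<open>\<one>\<close> is kept so that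
    \<open>card_image_mult_inv\<close> applies with \<open>g = \<one>\<close>.\<close>
  let ?B = "(\<lambda>x. \<one> \<otimes> inv x) ` A"
  have finA: "finite A" using fin A by (rule rev_finite_subset)
  have inB: "x \<in> ?B" if "inv x \<in> A" "x \<in> carrier G" for x
    using that by (intro image_eqI[of _ _ "inv x"]) auto
  have union: "A \<union> ?B = carrier G"
  proof
    show "A \<union> ?B \<subseteq> carrier G" using A by auto
    show "carrier G \<subseteq> A \<union> ?B" using cover inB by blast
  qed
  \<comment> \<open>For a self-inverse \<open>x\<close> the two alternatives in \<open>cover\<close>
    coincide, so \<open>x\<close> lies in \<open>A\<close> and is its own image in
    \<open>?B\<close>.\<close>
  have inter: "{x \<in> carrier G. x \<otimes> x = \<one>} \<subseteq> A \<inter> ?B"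
  proof clarify
    fix x assume x: "x \<in> carrier G" "x \<otimes> x = \<one>"
    then have "inv x = x" by (intro inv_equality)
    then show "x \<in> A \<inter> ?B" using cover[OF x(1)] inB x(1) by auto
  qed
  have "2 * card A = card (A \<union> ?B) + card (A \<inter> ?B)"
    using card_Un_Int[of A ?B] finA card_image_mult_inv[OF A one_closed] by simp
  moreover have "card {x \<in> carrier G. x \<otimes> x = \<one>} \<le> card (A \<inter> ?B)"
    using inter finA by (intro card_mono) auto
  \<comment> \<open>The facts above give \<open>\<ge>\<close>; \<open>card_missing_le\<close> gives
    \<open>\<le>\<close>.\<close>
  ultimately have "2 * card A = order G + card {x \<in> carrier G. x \<otimes> x = \<one>}"
    using card_missing_le[OF fin A one_closed miss] union by (simp add: order_def)
  then show thesis using that A miss by blast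
qed

text \<open>The doubled form avoids division on the natural numbers; halving is left to the
  reals.\<close>

lemma max_incomplete_card_2:
  assumes fin: "finite (carrier G)"
  shows "2 * max_incomplete_card G 2 = order G + card {x \<in> carrier G. x \<otimes> x = \<one>}"
proof -
  let ?C = "{card A | A. A \<subseteq> carrier G \<and> restricted_sumset G 2 A \<noteq> carrier G}"
  obtain A where A: "A \<subseteq> carrier G" "\<And>x y. x \<in> A \<Longrightarrow> y \<in> A \<Longrightarrow> x \<noteq> y \<Longrightarrow> x \<otimes> y \<noteq> \<one>"
    "2 * card A = order G + card {x \<in> carrier G. x \<otimes> x = \<one>}"
    using exists_card_missing_one[OF fin] by blast
  have bound: "c \<le> card A" if "c \<in> ?C" for c
  proof -
    from that obtain A' where A': "c = card A'" "A' \<subseteq> carrier G"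
      "restricted_sumset G 2 A' \<noteq> carrier G" by blast
    then obtain g where "g \<in> carrier G"
      "\<And>x y. x \<in> A' \<Longrightarrow> y \<in> A' \<Longrightarrow> x \<noteq> y \<Longrightarrow> x \<otimes> y \<noteq> g"
      using restricted_sumset_2_eq_carrier_iff[OF A'(2)] by auto
    \<comment> \<open>By \<open>A(3)\<close>, \<open>2 * card A\<close> is exactly the upper bound
      valid for every set that misses some element.\<close>
    then have "2 * card A' \<le> 2 * card A"
      unfolding A(3) by (rule card_missing_le[OF fin A'(2)])
    then show ?thesis using A' by simp
  qed
  have "card A \<in> ?C"
  proof -
    have "restricted_sumset G 2 A \<noteq> carrier G"
      unfolding restricted_sumset_2_eq_carrier_iff[OF A(1)] using A(2) one_closed by metis
    then show ?thesis using A(1) by blast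
  qed
  \<comment> \<open>The bound on cardinalities also gives the finiteness that \<open>Max\<close>
    requires.\<close>
  moreover have "finite ?C" using bound by (meson finite_nat_set_iff_bounded_le)
  ultimately have "max_incomplete_card G 2 = card A"
    unfolding max_incomplete_card_def using bound by (intro Max_eqI) auto
  then show ?thesis using A(3) by simp
qed

end

theorem theorem2p4:
  fixes G :: "('a, 'b) monoid_scheme" and n l :: nat
  assumes "comm_group G"
    and "finite (carrier G)"
    and "order G = n"
    and "n \<ge> 2"
    and "l = card {x \<in> carrier G. group.ord G x \<le> 2}"
  shows "real (max_incomplete_card G 2) = (real n + real l) / 2"
proof -
  interpret comm_group G by fact
  have "{x \<in> carrier G. ord x \<le> 2} = {x \<in> carrier G. x \<otimes>\<^bsub>G\<^esub> x = \<one>\<^bsub>G\<^esub>}"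
    using ord_le_2_iff[OF assms(2)] by blast
  then have "2 * max_incomplete_card G 2 = n + l"
    using max_incomplete_card_2[OF assms(2)] assms(3,5) by simp
  then have "2 * real (max_incomplete_card G 2) = real n + real l"
    by (metis of_nat_add of_nat_mult of_nat_numeral)
  then show ?thesis by simp
qed

end
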